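(* For any finite poset $\mathcal{P}$ we have $\operatorname{Tr}(\mathcal{P}^{\mathrm{op}})\cong\operatorname{Tr}(\mathcal{P})^{\mathrm{op}}$ as lattices. Explicitly, there is an order-reversing bijection $\gamma_{\mathcal{P}}\colon\operatorname{Tr}(\mathcal{P})\to\operatorname{Tr}(\mathcal{P}^{\mathrm{op}})$ defined by $\gamma_{\mathcal{P}}(R)=({}^{\square}R)^{\mathrm{op}}=(R^{\mathrm{op}})^{\square}$. In particular, $\#\operatorname{Tr}(\mathcal{P})=\#\operatorname{Tr}(\mathcal{P}^{\mathrm{op}})$.
   Context: Transfer system: for a finite poset $(\mathcal{P},\leq)$, a transfer system on $\mathcal{P}$ is a reflexive and transitive relation $R$ on $\mathcal{P}$ such that (1) $x\,R\,y$ implies $x\leq y$; and (2) for all $x,y,z\in\mathcal{P}$, if $x\,R\,z$ and $y\leq z$, then $m\,R\,y$ for every maximal element $m$ of $\{p\in \mathcal{P} : p\leq x \text{ and } p\leq y\}$. $\operatorname{Tr}(\mathcal{P})$ is the set of transfer systems on $\mathcal{P}$, partially ordered by inclusion of relations; it is a lattice. $\mathcal{P}^{\mathrm{op}}$ is the opposite poset: $x\leq y$ in $\mathcal{P}^{\mathrm{op}}$ iff $y\leq x$ in $\mathcal{P}$. Write $x\to y$ for the pair $(x,y)$ when $x\leq y$, and $x\to y\in R$ when $x\,R\,y$. For a relation $R$ on $\mathcal{P}$ refining $\leq$, $R^{\mathrm{op}}=\{y\to x\mid x\to y\in R\}$, a relation on $\mathcal{P}^{\mathrm{op}}$. In a poset,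 $x\to y$ has the right lifting property with respect to $a\to b$ (equivalently, $a\to b$ has the left lifting property with respect to $x\to y$) if [$a\leq x$ and $b\leq y$] implies $b\leq x$. For a relation $R$ refining the order, $R^{\square}$ is the set of all $x\to y$ having the right lifting property with respect to all $a\to b\in R$, and ${}^{\square}R$ is the set of all $a\to b$ having the left lifting property with respect to all $x\to y\in R$. Here ${}^{\square}R$ is computed in $\mathcal{P}$ and $(R^{\mathrm{op}})^{\square}$ is computed in $\mathcal{P}^{\mathrm{op}}$. *)

theory Defs
  imports "HOL-Algebra.Lattice"
begin

text \<open>
  A poset with underlying set \<open>A\<close> is given by its order relation \<open>r\<close> with
  \<open>partial_order_on A r\<close>, where \<open>(x, y) \<in> r\<close> means \<open>x \<le> y\<close>; its opposite is \<open>A\<close> with \<open>r\<inverse>\<close>.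
  For a relation \<open>R\<close> refining \<open>r\<close>, the opposite relation is likewise \<open>R\<inverse>\<close>.
\<close>

definition is_maximal_in :: "'a rel \<Rightarrow> 'a set \<Rightarrow> 'a \<Rightarrow> bool" where
  "is_maximal_in r S m \<longleftrightarrow> m \<in> S \<and> (\<forall>p\<in>S. (m, p) \<in> r \<longrightarrow> p = m)"

definition transfer_system :: "'a set \<Rightarrow> 'a rel \<Rightarrow> 'a rel \<Rightarrow> bool" where
  "transfer_system A r R \<longleftrightarrow>
     R \<subseteq> A \<times> A \<and> refl_on A R \<and> trans R \<and>
     (\<forall>x y. (x, y) \<in> R \<longrightarrow> (x, y) \<in> r) \<and>
     (\<forall>x\<in>A. \<forall>y\<in>A. \<forall>z\<in>A. (x, z) \<in> R \<and> (y, z) \<in> r \<longrightarrow>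
        (\<forall>m. is_maximal_in r {p \<in> A. (p, x) \<in> r \<and> (p, y) \<in> r} m \<longrightarrow> (m, y) \<in> R))"

definition Tr :: "'a set \<Rightarrow> 'a rel \<Rightarrow> 'a rel set" where
  "Tr A r = {R. transfer_system A r R}"

definition Tr_order :: "'a set \<Rightarrow> 'a rel \<Rightarrow> 'a rel gorder" where
  "Tr_order A r = \<lparr>carrier = Tr A r, eq = (=), le = (\<subseteq>)\<rparr>"

definition lifts :: "'a rel \<Rightarrow> 'a \<times> 'a \<Rightarrow> 'a \<times> 'a \<Rightarrow> bool" where
  \<comment> \<open>\<open>a \<rightarrow> b\<close> has the left lifting property with respect to \<open>x \<rightarrow> y\<close>\<close>
  "lifts r = (\<lambda>(a, b) (x, y). (a, x) \<in> r \<and> (b, y) \<in> r \<longrightarrow> (b, x) \<in> r)"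

definition right_lifting :: "'a rel \<Rightarrow> 'a rel \<Rightarrow> 'a rel" where
  "right_lifting r R = {g \<in> r. \<forall>f\<in>R. lifts r f g}"

definition left_lifting :: "'a rel \<Rightarrow> 'a rel \<Rightarrow> 'a rel" where
  "left_lifting r R = {f \<in> r. \<forall>g\<in>R. lifts r f g}"

definition gamma :: "'a rel \<Rightarrow> 'a rel \<Rightarrow> 'a rel" where
  "gamma r R = (left_lifting r R)\<inverse>"

definition lattice_iso :: "'a gorder \<Rightarrow> 'b gorder \<Rightarrow> ('a \<Rightarrow> 'b) \<Rightarrow> bool" where
  "lattice_iso L M f \<longleftrightarrow>
     lattice L \<and> lattice M \<and> bij_betw f (carrier L) (carrier M) \<and>
     (\<forall>x\<in>carrier L. \<forall>y\<in>carrier L.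
        f (x \<squnion>\<^bsub>L\<^esub> y) = f x \<squnion>\<^bsub>M\<^esub> f y \<and> f (x \<sqinter>\<^bsub>L\<^esub> y) = f x \<sqinter>\<^bsub>M\<^esub> f y)"

definition lattice_isomorphic :: "'a gorder \<Rightarrow> 'b gorder \<Rightarrow> bool" where
  "lattice_isomorphic L M \<longleftrightarrow> (\<exists>f. lattice_iso L M f)"

end

theory Submission
  imports Defs
begin

text \<open>
  A transfer system \<open>R\<close> on a finite poset is the right class of a weak factorization system:
  \<open>x \<le> y\<close> factors as \<open>x \<rightarrow> p \<rightarrow> y\<close> with \<open>p\<close> minimal among the elements above \<open>x\<close> that are
  \<open>R\<close>-related to \<open>y\<close>, and minimality puts \<open>x \<rightarrow> p\<close> into the left class. Hence \<open>R\<close> is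
  recovered as the right lifting class of its left lifting class, which says that
  \<open>\<gamma>\<close> for the opposite poset undoes \<open>\<gamma>\<close>. As \<open>\<gamma>\<close> reverses inclusions, it is an
  anti-isomorphism.
\<close>

section \<open>Finite posets and their transfer systems\<close>

locale finite_poset =
  fixes A :: "'a set" and r :: "'a rel"
  assumes finite_carrier: "finite A"
    and partial_order: "partial_order_on A r"
begin

text \<open>Interpreting the locale at \<open>r\<inverse>\<close> makes every result below available
  in dual form as well.\<close>

lemma dual_finite_poset: "finite_poset A (r\<inverse>)"
  using finite_carrier partial_order by unfold_locales simp_all

lemma carrierD: "(x, y) \<in> r \<Longrightarrow> x \<in> A \<and> y \<in> A"
  and reflI: "x \<in> A \<Longrightarrow> (x, x) \<in> r"
  and transD: "(x, y) \<in> r \<Longrightarrow> (y, z) \<in> r \<Longrightarrow> (x, z) \<in> r"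
  and antisymD: "(x, y) \<in> r \<Longrightarrow> (y, x) \<in> r \<Longrightarrow> x = y"
  using partial_order
  by (auto simp: partial_order_on_def preorder_on_def refl_on_def dest: transD antisymD)

lemma ex_maximal_above:
  assumes "S \<subseteq> A" and "x \<in> S"
  obtains m where "is_maximal_in r S m" and "(x, m) \<in> r"
proof -
  \<comment> \<open>Any element of \<open>S\<close> above a maximal element of \<open>?T\<close> is
    again above \<open>x\<close>, so maximality in \<open>?T\<close> gives maximality in
    \<open>S\<close>.\<close>
  let ?T = "{p \<in> S. (x, p) \<in> r}"
  have "\<exists>m\<in>?T. \<forall>p\<in>?T. p \<noteq> m \<longrightarrow> \<not> ((m, p) \<in> r \<and> m \<noteq> p)"
  proof (rule Finite_Set.bex_max_element)
    show "finite ?T"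
      using finite_carrier assms(1) by (auto intro: finite_subset)
    show "asymp_on ?T (\<lambda>p q. (p, q) \<in> r \<and> p \<noteq> q)"
      by (auto simp: asymp_on_def dest: antisymD)
    show "transp_on ?T (\<lambda>p q. (p, q) \<in> r \<and> p \<noteq> q)"
      by (auto simp: transp_on_def dest: antisymD intro: transD)
    show "?T \<noteq> {}"
      using assms reflI by blast
  qed
  then obtain m where "m \<in> ?T" and "\<forall>p\<in>?T. p \<noteq> m \<longrightarrow> (m, p) \<notin> r"
    by blast
  then have "is_maximal_in r S m"
    unfolding is_maximal_in_def by (blast intro: transD)
  with \<open>m \<in> ?T\<close> show thesis
    using that by blast
qed

lemma TrD:
  assumes "R \<in> Tr A r"
  shows "(x, y) \<in> R \<Longrightarrow> (x, y) \<in> r"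
    and "x \<in> A \<Longrightarrow> (x, x) \<in> R"
    and "(x, y) \<in> R \<Longrightarrow> (y, z) \<in> R \<Longrightarrow> (x, z) \<in> R"
  using assms unfolding Tr_def transfer_system_def refl_on_def trans_def by blast+

text \<open>The restriction axiom speaks of maximal common lower bounds only; finiteness provides
  one above any prescribed common lower bound \<open>w\<close>. This replaces base change along a
  meet, which need not exist.\<close>

lemma Tr_restrict_above:
  assumes "R \<in> Tr A r" and "(x, z) \<in> R" and "(y, z) \<in> r"
    and "(w, x) \<in> r" and "(w, y) \<in> r"
  obtains m where "(m, y) \<in> R" and "(m, x) \<in> r" and "(w, m) \<in> r"
proof -
  let ?S = "{p \<in> A. (p, x) \<in> r \<and> (p, y) \<in> r}"
  have "w \<in> ?S" and xyz: "x \<in> A" "y \<in> A" "z \<in> A"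
    using assms(3-5) carrierD by blast+
  then obtain m where m: "is_maximal_in r ?S m" "(w, m) \<in> r"
    using ex_maximal_above[of ?S w] by blast
  moreover have "(m, y) \<in> R"
    using assms(1-3) xyz m(1) unfolding Tr_def transfer_system_def by blast
  ultimately show thesis
    using that unfolding is_maximal_in_def by blast
qed

section \<open>Lifting classes and the image of \<open>gamma\<close>\<close>

lemma left_lifting_iff:
  "(a, b) \<in> left_lifting r R \<longleftrightarrow>
     (a, b) \<in> r \<and> (\<forall>x y. (x, y) \<in> R \<longrightarrow> (a, x) \<in> r \<longrightarrow> (b, y) \<in> r \<longrightarrow> (b, x) \<in> r)"
  unfolding left_lifting_def lifts_def by auto

text \<open>The lifting condition is self-dual: reversing the order turns both arrows around and
  exchanges their roles in the square.\<close>

lemma gamma_eq_right_lifting: "gamma r R = right_lifting (r\<inverse>) (R\<inverse>)"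
  unfolding gamma_def left_lifting_def right_lifting_def lifts_def by auto

text \<open>This is the restriction axiom for \<open>gamma r R\<close> in the opposite poset, where
  \<open>m\<close> is a minimal common upper bound of \<open>x\<close> and \<open>y\<close>. A
  square from \<open>y\<close> \<rightarrow> \<open>m\<close> to \<open>p\<close> \<rightarrow>
  \<open>q\<close> is first pulled back to an arrow of \<open>R\<close> ending in
  \<open>m\<close>.\<close>

lemma left_lifting_cobase_change:
  assumes R: "R \<in> Tr A r" and zx: "(z, x) \<in> left_lifting r R" and "(z, y) \<in> r"
    and m: "is_maximal_in (r\<inverse>) {p \<in> A. (p, x) \<in> r\<inverse> \<and> (p, y) \<in> r\<inverse>} m"
  shows "(y, m) \<in> left_lifting r R"
proof -
  have xm: "(x, m) \<in> r" and ym: "(y, m) \<in> r"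
    and min: "\<And>p. (x, p) \<in> r \<Longrightarrow> (y, p) \<in> r \<Longrightarrow> (p, m) \<in> r \<Longrightarrow> p = m"
    using m carrierD unfolding is_maximal_in_def by blast+
  have "(m, p) \<in> r" if pq: "(p, q) \<in> R" and yp: "(y, p) \<in> r" and mq: "(m, q) \<in> r" for p q
  proof -
    obtain n where n: "(n, m) \<in> R" "(n, p) \<in> r" "(y, n) \<in> r"
      using Tr_restrict_above[OF R pq mq yp ym] by blast
    \<comment> \<open>Lift \<open>z\<close> \<rightarrow> \<open>x\<close> against \<open>n\<close>
      \<rightarrow> \<open>m\<close>. Then \<open>n\<close> is a common upper bound of
      \<open>x\<close> and \<open>y\<close> below \<open>m\<close>.\<close>
    have "(x, n) \<in> r"
      using zx n(1) xm transD[OF \<open>(z, y) \<in> r\<close> n(3)] unfolding left_lifting_iff by blast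
    then have "n = m"
      using min n(3) TrD(1)[OF R n(1)] by blast
    then show ?thesis
      using n(2) by simp
  qed
  with ym show ?thesis
    unfolding left_lifting_iff by blast
qed

lemma gamma_in_Tr:
  assumes R: "R \<in> Tr A r"
  shows "gamma r R \<in> Tr A (r\<inverse>)"
proof -
  have "gamma r R \<subseteq> r\<inverse>"
    unfolding gamma_def left_lifting_def by auto
  moreover have "r\<inverse> \<subseteq> A \<times> A"
    using carrierD by auto
  moreover have "refl_on A (gamma r R)"
    unfolding gamma_def refl_on_def by (simp add: left_lifting_iff reflI)
  moreover have "trans (gamma r R)"
  proof (rule transI)
    fix c b a
    assume "(c, b) \<in> gamma r R" and "(b, a) \<in> gamma r R"
    then have ab: "(a, b) \<in> left_lifting r R" and bc: "(b, c) \<in> left_lifting r R"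
      by (simp_all add: gamma_def)
    then have "(a, b) \<in> r" and "(b, c) \<in> r"
      by (simp_all add: left_lifting_iff)
    \<comment> \<open>Two successive lifts: the first gives \<open>b\<close> \<le> \<open>x\<close>,
      which sets up the square for the second.\<close>
    moreover have "(c, x) \<in> r" if "(x, y) \<in> R" "(a, x) \<in> r" "(c, y) \<in> r" for x y
      using that ab bc transD[OF \<open>(b, c) \<in> r\<close> \<open>(c, y) \<in> r\<close>] unfolding left_lifting_iff by blast
    ultimately show "(c, a) \<in> gamma r R"
      unfolding gamma_def by (auto simp: left_lifting_iff intro: transD)
  qed
  ultimately show ?thesis
    using left_lifting_cobase_change[OF R]
    unfolding Tr_def transfer_system_def gamma_def by auto
qed

section \<open>Factorization and the inverse of \<open>gamma\<close>\<close>

lemma Tr_factorization: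
  assumes R: "R \<in> Tr A r" and xy: "(x, y) \<in> r"
  obtains p where "(x, p) \<in> left_lifting r R" and "(p, y) \<in> R"
proof -
  interpret op: finite_poset A "r\<inverse>"
    by (rule dual_finite_poset)
  let ?S = "{p \<in> A. (x, p) \<in> r \<and> (p, y) \<in> R}"
  have "y \<in> ?S"
    using xy carrierD TrD(2)[OF R] by blast
  \<comment> \<open>Maximal for the opposite order means minimal for \<open>r\<close>.\<close>
  then obtain p where p: "is_maximal_in (r\<inverse>) ?S p"
    using op.ex_maximal_above[of ?S y] by blast
  then have xp: "(x, p) \<in> r" and py: "(p, y) \<in> R"
    and min: "\<And>q. (x, q) \<in> r \<Longrightarrow> (q, y) \<in> R \<Longrightarrow> (q, p) \<in> r \<Longrightarrow> q = p"
    using carrierD unfolding is_maximal_in_def by blast+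
  have "(p, u) \<in> r" if uv: "(u, v) \<in> R" and xu: "(x, u) \<in> r" and pv: "(p, v) \<in> r" for u v
  proof -
    obtain n where n: "(n, p) \<in> R" "(n, u) \<in> r" "(x, n) \<in> r"
      using Tr_restrict_above[OF R uv pv xu xp] by blast
    \<comment> \<open>Composing \<open>n\<close> \<rightarrow> \<open>p\<close> with
      \<open>p\<close> \<rightarrow> \<open>y\<close> in \<open>R\<close> puts \<open>n\<close> into
      \<open>?S\<close>, so minimality of \<open>p\<close> applies.\<close>
    then have "n = p"
      using min TrD(1)[OF R n(1)] TrD(3)[OF R n(1) py] by blast
    then show ?thesis
      using n(2) by simp
  qed
  with xp have "(x, p) \<in> left_lifting r R"
    unfolding left_lifting_iff by blast
  then show thesis
    using py that by blast
qed

text \<open>The retract argument: lifting \<open>x\<close> \<rightarrow> \<open>y\<close> against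
  its own left factor \<open>x\<close> \<rightarrow> \<open>p\<close> forces \<open>p\<close> \<le>
  \<open>x\<close>, so the right factor is \<open>x\<close> \<rightarrow> \<open>y\<close>
  itself.\<close>

lemma right_lifting_left_lifting:
  assumes R: "R \<in> Tr A r"
  shows "right_lifting r (left_lifting r R) = R"
proof
  show "R \<subseteq> right_lifting r (left_lifting r R)"
    using TrD(1)[OF R] unfolding right_lifting_def left_lifting_def by auto
  show "right_lifting r (left_lifting r R) \<subseteq> R"
  proof (rule subrelI)
    fix x y
    assume xy: "(x, y) \<in> right_lifting r (left_lifting r R)"
    then have "(x, y) \<in> r"
      unfolding right_lifting_def by simp
    then obtain p where p: "(x, p) \<in> left_lifting r R" "(p, y) \<in> R"
      using Tr_factorization[OF R] by blast
    then have "(x, p) \<in> r" and "(p, y) \<in> r"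
      using TrD(1)[OF R] by (auto simp: left_lifting_iff)
    moreover have "lifts r (x, p) (x, y)"
      using xy p(1) unfolding right_lifting_def by blast
    ultimately have "(p, x) \<in> r"
      using carrierD reflI unfolding lifts_def by blast
    then have "p = x"
      using \<open>(x, p) \<in> r\<close> antisymD by blast
    then show "(x, y) \<in> R"
      using p(2) by simp
  qed
qed

lemma gamma_gamma:
  assumes "R \<in> Tr A r"
  shows "gamma (r\<inverse>) (gamma r R) = R"
proof -
  interpret op: finite_poset A "r\<inverse>"
    by (rule dual_finite_poset)
  show ?thesis
    \<comment> \<open>Written as a right lifting class, the outer \<open>gamma\<close> lives in the
      opposite of the opposite poset, and all converses cancel.\<close>
    using right_lifting_left_lifting[OF assms]
    unfolding op.gamma_eq_right_lifting by (simp add: gamma_def)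
qed

lemma bij_betw_gamma: "bij_betw (gamma r) (Tr A r) (Tr A (r\<inverse>))"
proof -
  interpret op: finite_poset A "r\<inverse>"
    by (rule dual_finite_poset)
  show ?thesis
    using gamma_in_Tr gamma_gamma op.gamma_in_Tr op.gamma_gamma
    by (intro bij_betw_byWitness[where f' = "gamma (r\<inverse>)"]) auto
qed

lemma gamma_antimono: "R \<subseteq> S \<Longrightarrow> gamma r S \<subseteq> gamma r R"
  unfolding gamma_def left_lifting_def by blast

text \<open>Order is reflected because the inverse map \<open>gamma (r\<inverse>)\<close> reverses
  inclusions too.\<close>

lemma gamma_subset_iff:
  assumes "R \<in> Tr A r" and "S \<in> Tr A r"
  shows "gamma r S \<subseteq> gamma r R \<longleftrightarrow> R \<subseteq> S"
proof -
  interpret op: finite_poset A "r\<inverse>"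
    by (rule dual_finite_poset)
  show ?thesis
    using gamma_antimono op.gamma_antimono gamma_gamma[OF assms(1)] gamma_gamma[OF assms(2)]
    by metis
qed

section \<open>The lattice of transfer systems\<close>

lemma order_in_Tr: "r \<in> Tr A r"
  using partial_order
  unfolding Tr_def transfer_system_def is_maximal_in_def partial_order_on_def preorder_on_def
  by auto

text \<open>Every axiom is a closure condition that passes to intersections; a nonempty family keeps
  the intersection inside \<open>r\<close>.\<close>

lemma Inter_in_Tr:
  assumes "\<R> \<subseteq> Tr A r" and "\<R> \<noteq> {}"
  shows "\<Inter>\<R> \<in> Tr A r"
proof -
  have tr: "transfer_system A r R" if "R \<in> \<R>" for R
    using assms(1) that unfolding Tr_def by blast
  obtain R0 where "R0 \<in> \<R>"
    using assms(2) by blast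
  have "\<Inter>\<R> \<subseteq> A \<times> A" and "\<Inter>\<R> \<subseteq> r"
    using \<open>R0 \<in> \<R>\<close> tr[OF \<open>R0 \<in> \<R>\<close>] unfolding transfer_system_def by blast+
  moreover have "refl_on A (\<Inter>\<R>)"
    using tr unfolding transfer_system_def refl_on_def by blast
  moreover have "trans (\<Inter>\<R>)"
    using tr unfolding transfer_system_def trans_def by blast
  moreover have "(m, y) \<in> \<Inter>\<R>"
    if "x \<in> A" "y \<in> A" "z \<in> A" "(x, z) \<in> \<Inter>\<R>" "(y, z) \<in> r"
      "is_maximal_in r {p \<in> A. (p, x) \<in> r \<and> (p, y) \<in> r} m" for x y z m
  proof
    fix R
    assume "R \<in> \<R>"
    then show "(m, y) \<in> R"
      using tr[OF \<open>R \<in> \<R>\<close>] that unfolding transfer_system_def by blast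
  qed
  ultimately show ?thesis
    unfolding Tr_def transfer_system_def by blast
qed

lemma lattice_Tr_order: "lattice (Tr_order A r)"
proof -
  interpret partial_order "Tr_order A r"
    by unfold_locales (auto simp: Tr_order_def)
  show ?thesis
  proof
    fix R S
    assume "R \<in> carrier (Tr_order A r)" and "S \<in> carrier (Tr_order A r)"
    then have R: "R \<in> Tr A r" and S: "S \<in> Tr A r"
      by (simp_all add: Tr_order_def)
    \<comment> \<open>A union of transfer systems need not be transitive, so the join is the
      intersection of all transfer systems containing both; \<open>r\<close> shows that there is
      one.\<close>
    let ?U = "{T \<in> Tr A r. R \<subseteq> T \<and> S \<subseteq> T}"
    have "r \<in> ?U"
      using order_in_Tr TrD(1)[OF R] TrD(1)[OF S] by auto
    then have "\<Inter>?U \<in> Tr A r"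
      by (intro Inter_in_Tr) auto
    then have "least (Tr_order A r) (\<Inter>?U) (Upper (Tr_order A r) {R, S})"
      using R S by (auto simp: least_def Upper_def Tr_order_def)
    then show "\<exists>s. least (Tr_order A r) s (Upper (Tr_order A r) {R, S})" ..
    have "R \<inter> S \<in> Tr A r"
      using R S Inter_in_Tr[of "{R, S}"] by simp
    then have "greatest (Tr_order A r) (R \<inter> S) (Lower (Tr_order A r) {R, S})"
      using R S by (auto simp: greatest_def Lower_def Tr_order_def)
    then show "\<exists>s. greatest (Tr_order A r) s (Lower (Tr_order A r) {R, S})" ..
  qed
qed

end

section \<open>From order isomorphisms to lattice isomorphisms\<close>

lemma order_iso_join:
  assumes "lattice L" and "lattice M" and bij: "bij_betw f (carrier L) (carrier M)"
    and le: "\<And>x y. x \<in> carrier L \<Longrightarrow> y \<in> carrier L \<Longrightarrow> f x \<sqsubseteq>\<^bsub>M\<^esub> f y \<longleftrightarrow> x \<sqsubseteq>\<^bsub>L\<^esub> y"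
    and x: "x \<in> carrier L" and y: "y \<in> carrier L"
  shows "f (x \<squnion>\<^bsub>L\<^esub> y) = f x \<squnion>\<^bsub>M\<^esub> f y"
proof -
  interpret L: lattice L by fact
  interpret M: lattice M by fact
  have f: "f v \<in> carrier M" if "v \<in> carrier L" for v
    using bij that by (rule bij_betwE[rule_format])
  \<comment> \<open>By surjectivity the join in \<open>M\<close> has a preimage, which is an upper
    bound of \<open>x\<close> and \<open>y\<close> since \<open>f\<close> reflects the
    order.\<close>
  have "f x \<squnion>\<^bsub>M\<^esub> f y \<in> f ` carrier L"
    using bij_betw_imp_surj_on[OF bij] f x y by simp
  then obtain v where v: "v \<in> carrier L" "f x \<squnion>\<^bsub>M\<^esub> f y = f v"
    by blast
  have "x \<sqsubseteq>\<^bsub>L\<^esub> v" and "y \<sqsubseteq>\<^bsub>L\<^esub> v"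
    using M.join_left[OF f[OF x] f[OF y]] M.join_right[OF f[OF x] f[OF y]] le x y v by simp_all
  then have "f (x \<squnion>\<^bsub>L\<^esub> y) \<sqsubseteq>\<^bsub>M\<^esub> f x \<squnion>\<^bsub>M\<^esub> f y"
    using le L.join_le x y v by simp
  moreover have "f x \<squnion>\<^bsub>M\<^esub> f y \<sqsubseteq>\<^bsub>M\<^esub> f (x \<squnion>\<^bsub>L\<^esub> y)"
    using f le L.join_left L.join_right x y by (intro M.join_le) simp_all
  ultimately show ?thesis
    using f x y by (intro M.le_antisym) simp_all
qed

lemma order_iso_imp_lattice_iso:
  assumes "lattice L" and "lattice M" and "bij_betw f (carrier L) (carrier M)"
    and "\<And>x y. x \<in> carrier L \<Longrightarrow> y \<in> carrier L \<Longrightarrow> f x \<sqsubseteq>\<^bsub>M\<^esub> f y \<longleftrightarrow> x \<sqsubseteq>\<^bsub>L\<^esub> y"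
  shows "lattice_iso L M f"
  \<comment> \<open>Meets are joins of the dual lattices, so the second instance covers
    them.\<close>
  using assms order_iso_join[OF assms] order_iso_join[of "inv_gorder L" "inv_gorder M" f]
  by (simp add: lattice_iso_def lattice.dual_lattice)

context finite_poset
begin

lemma lattice_iso_gamma:
  "lattice_iso (inv_gorder (Tr_order A r)) (Tr_order A (r\<inverse>)) (gamma r)"
proof (rule order_iso_imp_lattice_iso)
  show "lattice (inv_gorder (Tr_order A r))"
    by (rule lattice.dual_lattice[OF lattice_Tr_order])
  show "lattice (Tr_order A (r\<inverse>))"
    by (rule finite_poset.lattice_Tr_order[OF dual_finite_poset])
qed (simp_all add: Tr_order_def bij_betw_gamma gamma_subset_iff)

text \<open>The inverse of \<open>gamma r\<close> is the witness for
  \<open>lattice_isomorphic\<close> in the direction from the opposite poset.\<close>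

lemma lattice_iso_gamma_op:
  "lattice_iso (Tr_order A (r\<inverse>)) (inv_gorder (Tr_order A r)) (gamma (r\<inverse>))"
proof (rule order_iso_imp_lattice_iso)
  interpret op: finite_poset A "r\<inverse>"
    by (rule dual_finite_poset)
  show "lattice (inv_gorder (Tr_order A r))"
    by (rule lattice.dual_lattice[OF lattice_Tr_order])
  show "lattice (Tr_order A (r\<inverse>))"
    by (rule op.lattice_Tr_order)
  show "bij_betw (gamma (r\<inverse>)) (carrier (Tr_order A (r\<inverse>))) (carrier (inv_gorder (Tr_order A r)))"
    using op.bij_betw_gamma by (simp add: Tr_order_def)
  show "gamma (r\<inverse>) R \<sqsubseteq>\<^bsub>inv_gorder (Tr_order A r)\<^esub> gamma (r\<inverse>) S \<longleftrightarrow> R \<sqsubseteq>\<^bsub>Tr_order A (r\<inverse>)\<^esub> S"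
    if "R \<in> carrier (Tr_order A (r\<inverse>))" and "S \<in> carrier (Tr_order A (r\<inverse>))" for R S
    using that op.gamma_subset_iff by (simp add: Tr_order_def)
qed

end

theorem corollary6p10:
  fixes A :: "'a set" and r :: "'a rel"
  assumes "finite A" and "partial_order_on A r"
  shows "lattice_isomorphic (Tr_order A (r\<inverse>)) (inv_gorder (Tr_order A r)) \<and>
    lattice_iso (inv_gorder (Tr_order A r)) (Tr_order A (r\<inverse>)) (gamma r) \<and>
    bij_betw (gamma r) (Tr A r) (Tr A (r\<inverse>)) \<and>
    (\<forall>R\<in>Tr A r. \<forall>S\<in>Tr A r. R \<subseteq> S \<longleftrightarrow> gamma r S \<subseteq> gamma r R) \<and>
    (\<forall>R\<in>Tr A r. gamma r R = (left_lifting r R)\<inverse> \<and>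
                gamma r R = right_lifting (r\<inverse>) (R\<inverse>)) \<and>
    card (Tr A r) = card (Tr A (r\<inverse>))"
proof -
  interpret finite_poset A r
    using assms by unfold_locales
  show ?thesis
    using lattice_iso_gamma_op lattice_iso_gamma bij_betw_gamma gamma_subset_iff
      gamma_eq_right_lifting bij_betw_same_card[OF bij_betw_gamma]
    unfolding lattice_isomorphic_def by (auto simp: gamma_def[symmetric])
qed

end
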